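(* Let $d\in\mathbb N$, let $s_1,s_2,\omega\in\mathbb R$, and set $$N_0 = N_0(d,\omega,s_1,s_2) := d+\omega_+ + \tfrac12\big\{|s_1+\omega|+|s_2+\omega|\big\},\qquad \omega_+:=\max(\omega,0).$$ Let $\Theta:\mathbb Z^d\times\mathbb Z^d\times\mathbb Z^d\to\mathbb C$ be a tensor such that $\|\Theta\|_{\omega,N}<\infty$ for some $N\in\mathbb N$ with $N>N_0$, where $$\|\Theta\|_{\omega,N}:=\sup_{j,k,\ell\in\mathbb Z^d}\frac{|\Theta(j,k,\ell)|\,\langle |j-k|+|j-\ell|\rangle^{2N}}{\langle |j|+|k|\rangle^{\omega}\,\langle |j|+|\ell|\rangle^{\omega}}.$$ Then the operator $\mathcal T_\Theta$ given by $$(\mathcal T_\Theta(f,g))_j=\sum_{k\in\mathbb Z^d}\sum_{\ell\in\mathbb Z^d}\Theta(j,k,\ell)f_k g_\ell,\qquad j\in\mathbb Z^d,$$ is a bounded bilinear operator from $\ell^p_{s_1+\omega}(\mathbb Z^d)\times \ell^q_{s_2+\omega}(\mathbb Z^d)$ to $\ell^r_{s_1+s_2}(\mathbb Z^d)$ for any $1\le p,q,r\le\infty$ with $\frac1p+\frac1q=\frac1r$.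
   Context: For $k\in\mathbb Z^d$, $|k|$ is the Euclidean norm. $\langle x\rangle=(1+|x|^2)^{1/2}$ for $x$ a vector or a real number. For $s\in\mathbb R$ and $1\le p\le\infty$, $\ell^p_s(\mathbb Z^d)$ is the space of sequences $f=\{f_k\}_{k\in\mathbb Z^d}$ of complex numbers with finite norm $\|f\|_{\ell^p_s}=\big(\sum_{k\in\mathbb Z^d}\langle k\rangle^{sp}|f_k|^p\big)^{1/p}$ (for $p=\infty$: $\sup_k\langle k\rangle^s|f_k|$). *)

theory Defs
  imports "HOL-Analysis.Analysis"
begin

text \<open>
  The lattice \<open>\<int>\<^sup>d\<close> is the type \<open>int ^ 'd\<close>, with \<open>d = CARD('d) \<ge> 1\<close>. It carries no norm in the
  library, so its Euclidean structure is taken from \<open>real ^ 'd\<close> along the inclusion below.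
\<close>

definition lat :: "int ^ 'd \<Rightarrow> real ^ 'd" where
  "lat k = (\<chi> i. real_of_int (k $ i))"

definition latnorm :: "int ^ 'd \<Rightarrow> real" where
  "latnorm k = norm (lat k)"

text \<open>One definition serves for vectors and for real numbers.\<close>

definition jbracket :: "'a::real_normed_vector \<Rightarrow> real" where
  "jbracket x = sqrt (1 + (norm x)\<^sup>2)"

text \<open>
  Exponents \<open>p \<in> [1,\<infinity>]\<close> are extended nonnegative reals. The real-valued \<open>ell_norm\<close> is meaningful only
  on \<open>ell_space\<close>: the terms are nonnegative, so summability (boundedness if \<open>p = \<infinity>\<close>) says exactly
  that the norm is finite.
\<close>

definition ell_space :: "ennreal \<Rightarrow> real \<Rightarrow> (int ^ 'd \<Rightarrow> complex) set" where
  "ell_space p s =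
     {f. if p = \<infinity>
         then bdd_above (range (\<lambda>k. jbracket (lat k) powr s * cmod (f k)))
         else (\<lambda>k. jbracket (lat k) powr (s * enn2real p) * cmod (f k) powr enn2real p)
                summable_on UNIV}"

definition ell_norm :: "ennreal \<Rightarrow> real \<Rightarrow> (int ^ 'd \<Rightarrow> complex) \<Rightarrow> real" where
  "ell_norm p s f =
     (if p = \<infinity>
      then (SUP k. jbracket (lat k) powr s * cmod (f k))
      else (\<Sum>\<^sub>\<infinity>k. jbracket (lat k) powr (s * enn2real p) * cmod (f k) powr enn2real p)
             powr (1 / enn2real p))"

definition N0 :: "nat \<Rightarrow> real \<Rightarrow> real \<Rightarrow> real \<Rightarrow> real" where
  "N0 d \<omega> s1 s2 = real d + max \<omega> 0 + 1/2 * (\<bar>s1 + \<omega>\<bar> + \<bar>s2 + \<omega>\<bar>)"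

definition tensor_norm ::
    "real \<Rightarrow> nat \<Rightarrow> (int ^ 'd \<Rightarrow> int ^ 'd \<Rightarrow> int ^ 'd \<Rightarrow> complex) \<Rightarrow> ennreal" where
  "tensor_norm \<omega> N \<Theta> =
     (SUP (j, k, l). ennreal
        (cmod (\<Theta> j k l) * jbracket (latnorm (j - k) + latnorm (j - l)) ^ (2 * N) /
         (jbracket (latnorm j + latnorm k) powr \<omega> * jbracket (latnorm j + latnorm l) powr \<omega>)))"

definition tensor_op ::
    "(int ^ 'd \<Rightarrow> int ^ 'd \<Rightarrow> int ^ 'd \<Rightarrow> complex) \<Rightarrow>
     (int ^ 'd \<Rightarrow> complex) \<Rightarrow> (int ^ 'd \<Rightarrow> complex) \<Rightarrow> (int ^ 'd \<Rightarrow> complex)" where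
  "tensor_op \<Theta> f g = (\<lambda>j. \<Sum>\<^sub>\<infinity>k. \<Sum>\<^sub>\<infinity>l. \<Theta> j k l * f k * g l)"

text \<open>
  Since \<open>infsum\<close> of a non-summable family is \<open>0\<close>, convergence of the series in \<open>tensor_op\<close> has to be
  asserted separately.
\<close>

definition tensor_op_converges ::
    "(int ^ 'd \<Rightarrow> int ^ 'd \<Rightarrow> int ^ 'd \<Rightarrow> complex) \<Rightarrow>
     (int ^ 'd \<Rightarrow> complex) \<Rightarrow> (int ^ 'd \<Rightarrow> complex) \<Rightarrow> bool" where
  "tensor_op_converges \<Theta> f g \<longleftrightarrow>
     (\<forall>j. (\<forall>k. (\<lambda>l. \<Theta> j k l * f k * g l) summable_on UNIV) \<and>
          (\<lambda>k. \<Sum>\<^sub>\<infinity>l. \<Theta> j k l * f k * g l) summable_on UNIV)"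

text \<open>
  The library's \<open>bounded_bilinear\<close> concerns maps between whole normed types; here the spaces are
  sets of complex-valued functions with pointwise operations, each with its own norm.
\<close>

definition bounded_bilinear_between ::
    "('a \<Rightarrow> complex) set \<Rightarrow> (('a \<Rightarrow> complex) \<Rightarrow> real) \<Rightarrow>
     ('b \<Rightarrow> complex) set \<Rightarrow> (('b \<Rightarrow> complex) \<Rightarrow> real) \<Rightarrow>
     ('c \<Rightarrow> complex) set \<Rightarrow> (('c \<Rightarrow> complex) \<Rightarrow> real) \<Rightarrow>
     (('a \<Rightarrow> complex) \<Rightarrow> ('b \<Rightarrow> complex) \<Rightarrow> ('c \<Rightarrow> complex)) \<Rightarrow> bool" where
  "bounded_bilinear_between X nX Y nY Z nZ T \<longleftrightarrow>
     (\<forall>f\<in>X. \<forall>g\<in>Y. T f g \<in> Z) \<and>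
     (\<forall>f\<in>X. \<forall>f'\<in>X. \<forall>g\<in>Y. T (\<lambda>k. f k + f' k) g = (\<lambda>j. T f g j + T f' g j)) \<and>
     (\<forall>f\<in>X. \<forall>g\<in>Y. \<forall>g'\<in>Y. T f (\<lambda>l. g l + g' l) = (\<lambda>j. T f g j + T f g' j)) \<and>
     (\<forall>c. \<forall>f\<in>X. \<forall>g\<in>Y. T (\<lambda>k. c * f k) g = (\<lambda>j. c * T f g j)) \<and>
     (\<forall>c. \<forall>f\<in>X. \<forall>g\<in>Y. T f (\<lambda>l. c * g l) = (\<lambda>j. c * T f g j)) \<and>
     (\<exists>C. \<forall>f\<in>X. \<forall>g\<in>Y. nZ (T f g) \<le> C * nX f * nY g)"

end

(*
  Write 2N = (a + e1) + (a + e2) with e_i = max(omega, 0) + |s_i + omega|; then N > N0 says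
  exactly a > d. Peetre's inequality trades the weight <j>^s_i <|j|+|k|>^omega for
  <k>^(s_i + omega) at the cost of a factor <j-k>^e_i, so after weighting Theta(j,k,l) is dominated
  by K(j-k) K(j-l) with K = <.>^(-a) summable on Z^d. Hence T(f,g) is dominated by the product
  (K * F)(K * G) of two convolutions of the weighted sequences, and Young's inequality
  l^1 * l^p -> l^p followed by Hoelder's inequality gives the bound.
*)

theory Submission
  imports Defs
begin

text \<open>The weight in the tensor norm couples k and l through <|j-k|+|j-l|>. The variables
  decouple because this bracket is at least as large as both <j-k> and <j-l>, so its power can be
  bounded below by a product of powers of the two. These powers may differ: each receives the cost
  e_i of its own weight transfer plus the common exponent a. Only the sum e1 + e2 is therefore
  constrained, which is the origin of the average in \<open>N0\<close>. The share max(\<omega>, 0)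
  of the cost arises for \<omega> > 0 only, since <|j|+|k|>^\<omega> is at most <j>^\<omega> for
  \<omega> \<le> 0. Convolutions are infinite sums and the exponents may be infinite; estimating
  finite partial sums means that only finite sums are exchanged, with one passage to the
  limit.\<close>

text \<open>
  \<open>lp_le p A F\<close> says \<open>\<parallel>F\<parallel>\<^sub>p \<le> A\<close> for nonnegative \<open>F\<close> and \<open>A\<close> (\<open>powr\<close> is not meaningful for negative
  values), through finite partial sums so that no summability has to be carried along.
\<close>

definition lp_le :: "ennreal \<Rightarrow> real \<Rightarrow> ('a \<Rightarrow> real) \<Rightarrow> bool" where
  "lp_le p A F \<longleftrightarrow>
     (if p = \<infinity> then \<forall>k. F k \<le> A
      else \<forall>S. finite S \<longrightarrow> (\<Sum>k\<in>S. F k powr enn2real p) \<le> A powr enn2real p)"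

section \<open>Elementary properties of l^p bounds\<close>

lemma lp_le_top [simp]: "lp_le top A F \<longleftrightarrow> (\<forall>k. F k \<le> A)"
  by (simp add: lp_le_def)

lemma lp_le_ennreal:
  "0 \<le> p \<Longrightarrow> lp_le (ennreal p) A F \<longleftrightarrow> (\<forall>S. finite S \<longrightarrow> (\<Sum>k\<in>S. F k powr p) \<le> A powr p)"
  by (simp add: lp_le_def)

text \<open>Testing on one-point sets bounds every term by the norm. This makes F vanish when A = 0,
  and it gives the crude majorant A * K for the terms of a convolution.\<close>

lemma lp_le_pointwise:
  assumes "1 \<le> p" "lp_le p A F" "0 \<le> A"
  shows "F k \<le> A"
proof (cases p)
  case (real p')
  then have "1 \<le> p'" using assms(1) by (metis ennreal_ge_1)
  moreover have "F k powr p' \<le> A powr p'"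
    using assms(2) real by (auto simp: lp_le_ennreal dest!: spec[of _ "{k}"])
  ultimately show ?thesis
    using powr_less_mono2[of p' A "F k"] assms(3) by fastforce
qed (use assms in auto)

lemma lp_le_mono:
  assumes "lp_le p A F" "\<And>k. 0 \<le> G k" "\<And>k. G k \<le> F k"
  shows "lp_le p A G"
proof (cases p)
  case (real p')
  have "(\<Sum>k\<in>S. G k powr p') \<le> A powr p'" if "finite S" for S
  proof -
    have "(\<Sum>k\<in>S. G k powr p') \<le> (\<Sum>k\<in>S. F k powr p')"
      using assms real by (intro sum_mono powr_mono2) auto
    also have "\<dots> \<le> A powr p'" using assms(1) real that by (simp add: lp_le_ennreal)
    finally show ?thesis .
  qed
  then show ?thesis using real by (simp add: lp_le_ennreal)
next
  case top
  then show ?thesis using assms(1,3) by (auto intro: order_trans)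
qed

lemma lp_le_cmult:
  assumes "lp_le p A F" "\<And>k. 0 \<le> F k" "0 \<le> A" "0 \<le> c"
  shows "lp_le p (c * A) (\<lambda>k. c * F k)"
proof (cases p)
  case (real p')
  then show ?thesis using assms
    by (simp add: lp_le_ennreal powr_mult sum_distrib_left[symmetric] mult_left_mono)
qed (use assms in \<open>auto intro: mult_left_mono\<close>)

section \<open>Hoelder's inequality\<close>

text \<open>After normalising by A and B this is weighted AM-GM with weights r/p and r/q, summed
  over k. Division by A and B sets apart the case where one of them is zero, in which the product F
  * G vanishes identically.\<close>

lemma Hoelder_lp_le_finite:
  fixes p q r :: real
  assumes pqr: "1 \<le> p" "1 \<le> q" "1 \<le> r" "1 / p + 1 / q = 1 / r"
    and F: "lp_le (ennreal p) A F" "\<And>k. 0 \<le> F k" "0 \<le> A"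
    and G: "lp_le (ennreal q) B G" "\<And>k. 0 \<le> G k" "0 \<le> B"
  shows "lp_le (ennreal r) (A * B) (\<lambda>k. F k * G k)"
proof (cases "A = 0 \<or> B = 0")
  case True
  have "F k * G k = 0" for k
  proof -
    have "F k \<le> A" "G k \<le> B"
      using lp_le_pointwise F G pqr by (metis ennreal_ge_1)+
    then show ?thesis using True F(2)[of k] G(2)[of k] by auto
  qed
  then have "(\<Sum>k\<in>S. (F k * G k) powr r) = 0" for S
    by (intro sum.neutral) (simp del: mult_eq_0_iff)
  then show ?thesis using pqr by (simp add: lp_le_ennreal)
next
  case False
  then have pos: "0 < A" "0 < B" using F G by auto
  have sum1: "r / p + r / q = 1"
  proof -
    have "r / p + r / q = r * (1 / p + 1 / q)" by (simp add: distrib_left)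
    then show ?thesis using pqr by simp
  qed
  have point: "(F k * G k) powr r \<le>
      (A * B) powr r * (r / p * (F k powr p / A powr p) + r / q * (G k powr q / B powr q))" for k
  proof (cases "F k = 0 \<or> G k = 0")
    case True
    then show ?thesis using pqr by (auto intro!: mult_nonneg_nonneg add_nonneg_nonneg)
  next
    case False
    then have pos': "0 < F k" "0 < G k" using F(2)[of k] G(2)[of k] by auto
    \<comment> \<open>The exponents are chosen so that the left side collapses to the r-th power of
      the normalised product.\<close>
    have "((F k / A) powr p) powr (r / p) * ((G k / B) powr q) powr (r / q)
        \<le> r / p * (F k / A) powr p + r / q * (G k / B) powr q"
      using pqr sum1 pos pos' by (intro Youngs_inequality_0) auto
    moreover have "((F k / A) powr p) powr (r / p) * ((G k / B) powr q) powr (r / q)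
        = (F k * G k) powr r / (A * B) powr r"
      using pqr pos pos' by (simp add: powr_powr powr_mult powr_divide)
    ultimately have "(F k * G k) powr r / (A * B) powr r
        \<le> r / p * (F k powr p / A powr p) + r / q * (G k powr q / B powr q)"
      using pos pos' by (simp add: powr_divide)
    then show ?thesis using pos by (simp add: field_simps)
  qed
  have "(\<Sum>k\<in>S. (F k * G k) powr r) \<le> (A * B) powr r" if S: "finite S" for S
  proof -
    have "(\<Sum>k\<in>S. F k powr p) / A powr p \<le> 1" "(\<Sum>k\<in>S. G k powr q) / B powr q \<le> 1"
      using F G S pos pqr by (simp_all add: lp_le_ennreal)
    then have le: "r / p * ((\<Sum>k\<in>S. F k powr p) / A powr p) + r / q * ((\<Sum>k\<in>S. G k powr q) / B powr q) 
        \<le> r / p * 1 + r / q * 1"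
      using pqr by (intro add_mono mult_left_mono) auto
    have "(\<Sum>k\<in>S. (F k * G k) powr r) \<le>
      (\<Sum>k\<in>S. (A * B) powr r * (r / p * (F k powr p / A powr p) + r / q * (G k powr q / B powr q)))"
      by (intro sum_mono point)
    also have "\<dots> = (A * B) powr r *
        (r / p * ((\<Sum>k\<in>S. F k powr p) / A powr p) + r / q * ((\<Sum>k\<in>S. G k powr q) / B powr q))"
      by (simp add: sum_distrib_left sum.distrib sum_divide_distrib distrib_left)
    also have "\<dots> \<le> (A * B) powr r * 1"
      using le sum1 by (intro mult_left_mono) auto
    finally show ?thesis by simp
  qed
  then show ?thesis using pqr by (simp add: lp_le_ennreal)
qed

lemma Hoelder_lp_le:
  assumes pqr: "1 \<le> p" "1 \<le> q" "1 \<le> r" "1 / p + 1 / q = 1 / r"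
    and F: "lp_le p A F" "\<And>k. 0 \<le> F k" "0 \<le> A"
    and G: "lp_le q B G" "\<And>k. 0 \<le> G k" "0 \<le> B"
  shows "lp_le r (A * B) (\<lambda>k. F k * G k)"
proof -
  \<comment> \<open>Since 1/\<infinity> = 0, an infinite p or q turns the exponent relation into
    equality of two reciprocals; injectivity then identifies r with the other exponent.\<close>
  have inv_inj: "x = y" if "1 / x = 1 / y" "1 \<le> x" "1 \<le> y" for x y :: ennreal
  proof (cases "x = top \<or> y = top")
    case True
    then show ?thesis using that(1) by (auto simp: divide_ennreal_def dest: sym)
  next
    case False
    then obtain a b where ab: "x = ennreal a" "y = ennreal b" by (cases x; cases y) auto
    then have "1 \<le> a" "1 \<le> b" using that(2,3) by (metis ennreal_ge_1)+
    then show ?thesis using that(1) ab by (simp add: divide_ennreal_def inverse_ennreal)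
  qed
  consider "p = \<infinity>" | "q = \<infinity>" | "p \<noteq> \<infinity>" "q \<noteq> \<infinity>" by blast
  then show ?thesis
  proof cases
    case 1
    then have "r = q" using pqr inv_inj[of q r] by simp
    moreover have "F k * G k \<le> A * G k" for k
      using F(1) G(2) 1 by (simp add: mult_right_mono)
    ultimately show ?thesis
      using lp_le_cmult[OF G F(3)] F(2) G(2) by (auto intro: lp_le_mono)
  next
    case 2
    then have "r = p" using pqr inv_inj[of p r] by simp
    moreover have "F k * G k \<le> B * F k" for k
      using G(1) F(2) 2 by (simp add: mult_right_mono mult.commute[of "F k"])
    ultimately show ?thesis
      using lp_le_cmult[OF F G(3)] F(2) G(2) by (auto intro: lp_le_mono simp: mult.commute[of A])
  next
    case 3
    then obtain p' q' where p': "p = ennreal p'" "0 \<le> p'" and q': "q = ennreal q'" "0 \<le> q'"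
      by (cases p; cases q) auto
    then have ge1: "1 \<le> p'" "1 \<le> q'" using pqr(1,2) by (metis ennreal_ge_1)+
    have inv: "1 / ennreal x = ennreal (1 / x)" if "1 \<le> x" for x
      using divide_ennreal[of 1 x] that by simp
    have eq: "1 / r = ennreal (1 / p' + 1 / q')"
      using pqr(4) p' q' ge1 inv by (simp add: ennreal_plus[symmetric] del: ennreal_plus)
    have "r \<noteq> \<infinity>"
    proof
      assume "r = \<infinity>"
      then have "1 / p' + 1 / q' \<le> 0" using eq by (simp add: ennreal_eq_0_iff)
      moreover have "0 < 1 / p'" "0 < 1 / q'" using ge1 by auto
      ultimately show False by linarith
    qed
    then obtain r' where r': "r = ennreal r'" "0 \<le> r'" by (cases r) auto
    then have r1: "1 \<le> r'" using pqr(3) by (metis ennreal_ge_1)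
    have "1 / p' + 1 / q' = 1 / r'"
      using eq r'(1) inv[OF r1] r1 ge1 by (simp del: ennreal_plus)
    then show ?thesis
      using Hoelder_lp_le_finite[OF ge1 r1] F G unfolding p'(1) q'(1) r'(1) by blast
  qed
qed

section \<open>Young's convolution inequality\<close>

text \<open>Jensen's inequality for the p-th power with weights of total mass at most \<kappa>. In
  Young's inequality the weights are a row of the kernel, and the factor \<kappa>^(p-1) is completed
  to \<kappa>^p by the column sums.\<close>

lemma sum_powr_le:
  fixes w x :: "'a \<Rightarrow> real"
  assumes p: "1 \<le> p" and w: "\<And>k. k \<in> S \<Longrightarrow> 0 \<le> w k" "(\<Sum>k\<in>S. w k) \<le> \<kappa>"
    and x: "\<And>k. k \<in> S \<Longrightarrow> 0 \<le> x k"
  shows "(\<Sum>k\<in>S. w k * x k) powr p \<le> \<kappa> powr (p - 1) * (\<Sum>k\<in>S. w k * x k powr p)"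
proof -
  define X where "X = (\<Sum>k\<in>S. w k * x k)"
  have X0: "0 \<le> X" unfolding X_def using w x by (auto intro: sum_nonneg)
  have \<kappa>0: "0 \<le> \<kappa>" using w by (meson order_trans sum_nonneg)
  show ?thesis
  proof (cases "X = 0")
    case True
    then show ?thesis using w x by (auto simp: X_def[symmetric] intro!: mult_nonneg_nonneg sum_nonneg)
  next
    case False
    then have X: "0 < X" using X0 by simp
    have "\<kappa> \<noteq> 0"
    proof
      assume "\<kappa> = 0"
      then have "sum w S = 0" using w by (meson antisym sum_nonneg)
      then have "X = 0" unfolding X_def
        \<comment> \<open>For infinite S the sum X is 0 by convention.\<close>
        by (cases "finite S") (use w in \<open>auto simp: sum_nonneg_eq_0_iff\<close>)
      then show False using X by simp
    qed
    then have \<kappa>: "0 < \<kappa>" using \<kappa>0 by simp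
    define t where "t = X / \<kappa>"
    have t: "0 < t" using X \<kappa> by (simp add: t_def)
    \<comment> \<open>Weighted AM-GM with equality at \<open>y = t\<close>; this is Jensen's inequality at the mean \<open>t\<close>.\<close>
    have AMGM: "y \<le> 1 / p * (y powr p * t powr (1 - p)) + (1 - 1 / p) * t" if "0 \<le> y" for y
    proof (cases "y = 0")
      case True
      then show ?thesis using t p by simp
    next
      case False
      then have y: "0 < y" using that by simp
      have "y = (y powr p * t powr (1 - p)) powr (1 / p) * t powr (1 - 1 / p)"
        using y t p by (simp add: powr_mult powr_powr powr_add[symmetric] field_simps)
      also have "\<dots> \<le> 1 / p * (y powr p * t powr (1 - p)) + (1 - 1 / p) * t"
        using y t p by (intro Youngs_inequality_0) auto
      finally show ?thesis .
    qed
    define Y where "Y = (\<Sum>k\<in>S. w k * x k powr p)"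
    have "X \<le> (\<Sum>k\<in>S. w k * (1 / p * (x k powr p * t powr (1 - p)) + (1 - 1 / p) * t))"
      unfolding X_def using w x by (intro sum_mono mult_left_mono AMGM) auto
    also have "\<dots> = 1 / p * t powr (1 - p) * Y + (1 - 1 / p) * t * sum w S"
      by (simp add: Y_def sum_distrib_left sum_distrib_right sum.distrib distrib_left mult_ac)
    also have "\<dots> \<le> 1 / p * t powr (1 - p) * Y + (1 - 1 / p) * t * \<kappa>"
      using w t p by (intro add_left_mono mult_left_mono) auto
    \<comment> \<open>The choice t = X / \<kappa> turns this term into a fraction of X that the left
      side absorbs, leaving X / p there.\<close>
    also have "(1 - 1 / p) * t * \<kappa> = X - 1 / p * X"
      using \<kappa> by (simp add: t_def algebra_simps)
    finally have "1 / p * X \<le> 1 / p * (t powr (1 - p) * Y)" by simp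
    then have "X \<le> t powr (1 - p) * Y" using p by (simp add: field_simps)
    then have "X * t powr (p - 1) \<le> Y"
      using t by (simp add: powr_diff field_simps)
    moreover have "X powr p = X * t powr (p - 1) * \<kappa> powr (p - 1)"
      using X \<kappa> by (simp add: t_def powr_divide powr_diff)
    ultimately show ?thesis
      unfolding X_def[symmetric] Y_def[symmetric] by (simp add: mult.commute[of _ "\<kappa> powr (p - 1)"] mult_left_mono)
  qed
qed

text \<open>Rows and columns of the kernel \<open>K (j - k)\<close> have mass at most \<kappa>. For
  finite p, Jensen's inequality along rows gives \<kappa>^(p-1), and exchanging the sums and summing
  columns gives the last factor \<kappa>. For p = \<infinity> the row mass gives the bound
  directly.\<close>

lemma Young_lp_le:
  fixes K F :: "'a::ab_group_add \<Rightarrow> real"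
  assumes p: "1 \<le> p" and K: "\<And>m. 0 \<le> K m" "K summable_on UNIV"
    and F: "lp_le p A F" "\<And>k. 0 \<le> F k" "0 \<le> A"
  shows summable_convolution: "(\<lambda>k. K (j - k) * F k) summable_on UNIV"
    and lp_le_convolution: "lp_le p (infsum K UNIV * A) (\<lambda>j. \<Sum>\<^sub>\<infinity>k. K (j - k) * F k)"
proof -
  define \<kappa> where "\<kappa> = infsum K UNIV"
  have \<kappa>0: "0 \<le> \<kappa>" unfolding \<kappa>_def using K by (simp add: infsum_nonneg)
  have bij: "bij_betw (\<lambda>k. j - k) UNIV UNIV" for j :: 'a
    by (rule bij_betw_byWitness[of _ "\<lambda>k. j - k"]) auto
  have Kj: "(\<lambda>k. K (j - k)) summable_on UNIV" "(\<Sum>\<^sub>\<infinity>k. K (j - k)) = \<kappa>" for j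
    using summable_on_reindex_bij_betw[OF bij[of j], of K]
      infsum_reindex_bij_betw[OF bij[of j], of K] K by (auto simp: \<kappa>_def)
  have sum_r: "(\<Sum>k\<in>T. K (j - k)) \<le> \<kappa>" if "finite T" for T j
    using finite_sum_le_infsum[OF Kj(1)[of j] that] K Kj(2)[of j] by simp
  have sum_l: "(\<Sum>j\<in>S. K (j - k)) \<le> \<kappa>" if "finite S" for S k
  proof -
    have "(\<Sum>j\<in>S. K (j - k)) = sum K ((\<lambda>j. j - k) ` S)"
      by (subst sum.reindex) (auto simp: inj_on_def)
    also have "\<dots> \<le> \<kappa>" unfolding \<kappa>_def
      using that K by (intro finite_sum_le_infsum) auto
    finally show ?thesis .
  qed
  have FA: "F k \<le> A" for k using lp_le_pointwise[OF p F(1,3)] .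
  have le: "K (j - k) * F k \<le> A * K (j - k)" for j k
    using FA[of k] K(1)[of "j - k"] by (simp add: mult_right_mono mult.commute[of _ "F k"])
  have summ: "(\<lambda>k. K (j - k) * F k) summable_on UNIV" for j
    by (rule summable_on_comparison_test[OF summable_on_cmult_right[OF Kj(1)[of j], of A]])
       (use K F le in auto)
  then show "(\<lambda>k. K (j - k) * F k) summable_on UNIV" .
  show "lp_le p (infsum K UNIV * A) (\<lambda>j. \<Sum>\<^sub>\<infinity>k. K (j - k) * F k)"
    unfolding \<kappa>_def[symmetric]
  proof (cases p)
    case top
    have "(\<Sum>\<^sub>\<infinity>k. K (j - k) * F k) \<le> \<kappa> * A" for j
    proof -
      have "(\<Sum>\<^sub>\<infinity>k. K (j - k) * F k) \<le> (\<Sum>\<^sub>\<infinity>k. A * K (j - k))"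
        using summ Kj by (intro infsum_mono le summable_on_cmult_right)
      also have "\<dots> = \<kappa> * A"
        using Kj(2)[of j] by (simp add: infsum_cmult_right')
      finally show ?thesis .
    qed
    then show "lp_le p (\<kappa> * A) (\<lambda>j. \<Sum>\<^sub>\<infinity>k. K (j - k) * F k)" using top by simp
  next
    case (real p')
    then have p1: "1 \<le> p'" using p by (metis ennreal_ge_1)
    have "(\<Sum>j\<in>S. (\<Sum>\<^sub>\<infinity>k. K (j - k) * F k) powr p') \<le> (\<kappa> * A) powr p'" if S: "finite S" for S
    \<comment> \<open>The inner sum is truncated to a finite T, where the bound is uniform in T; for
      fixed finite S the p'-th powers are continuous in the limit over T.\<close>
    proof (rule tendsto_upperbound)
      show "((\<lambda>T. \<Sum>j\<in>S. (\<Sum>k\<in>T. K (j - k) * F k) powr p') \<longlongrightarrow>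
          (\<Sum>j\<in>S. (\<Sum>\<^sub>\<infinity>k. K (j - k) * F k) powr p')) (finite_subsets_at_top UNIV)"
        using p1 summ K F
        by (intro tendsto_sum tendsto_powr2 infsum_tendsto tendsto_const always_eventually)
           (auto intro!: sum_nonneg)
      have "(\<Sum>j\<in>S. (\<Sum>k\<in>T. K (j - k) * F k) powr p') \<le> (\<kappa> * A) powr p'" if T: "finite T" for T
      proof -
        have "(\<Sum>j\<in>S. (\<Sum>k\<in>T. K (j - k) * F k) powr p')
            \<le> (\<Sum>j\<in>S. \<kappa> powr (p' - 1) * (\<Sum>k\<in>T. K (j - k) * F k powr p'))"
          using p1 K F T sum_r by (intro sum_mono sum_powr_le) auto
        also have "\<dots> = \<kappa> powr (p' - 1) * (\<Sum>k\<in>T. F k powr p' * (\<Sum>j\<in>S. K (j - k)))"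
          by (subst sum_distrib_left[symmetric], subst sum.swap) (simp add: sum_distrib_left mult.commute)
        also have "\<dots> \<le> \<kappa> powr (p' - 1) * (\<Sum>k\<in>T. F k powr p' * \<kappa>)"
          using S sum_l by (intro mult_left_mono sum_mono) auto
        also have "\<dots> = \<kappa> powr (p' - 1) * \<kappa> * (\<Sum>k\<in>T. F k powr p')"
          by (simp add: sum_distrib_left sum_distrib_right mult_ac)
        also have "\<kappa> powr (p' - 1) * \<kappa> = \<kappa> powr p'"
          using \<kappa>0 by (cases "\<kappa> = 0") (use p1 in \<open>auto simp: powr_diff\<close>)
        also have "\<kappa> powr p' * (\<Sum>k\<in>T. F k powr p') \<le> \<kappa> powr p' * A powr p'"
          using F(1) T real by (intro mult_left_mono) (auto simp: lp_le_ennreal)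
        finally show ?thesis using \<kappa>0 F(3) by (simp add: powr_mult)
      qed
      then show "\<forall>\<^sub>F T in finite_subsets_at_top UNIV.
          (\<Sum>j\<in>S. (\<Sum>k\<in>T. K (j - k) * F k) powr p') \<le> (\<kappa> * A) powr p'"
        by (simp add: eventually_finite_subsets_at_top_weakI)
    qed simp
    then show "lp_le p (\<kappa> * A) (\<lambda>j. \<Sum>\<^sub>\<infinity>k. K (j - k) * F k)"
      using real by (simp add: lp_le_ennreal)
  qed
qed

section \<open>Japanese brackets and transfer of weights\<close>

lemma jbracket_lat: "jbracket (lat k) = jbracket (latnorm k)"
  by (simp add: jbracket_def latnorm_def)

lemma jbracket_ge_1: "1 \<le> jbracket x"
  by (simp add: jbracket_def)

lemma jbracket_pos: "0 < jbracket x"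
  using jbracket_ge_1[of x] by linarith

lemma jbracket_mono:
  fixes x y :: real
  shows "0 \<le> x \<Longrightarrow> x \<le> y \<Longrightarrow> jbracket x \<le> jbracket y"
  by (simp add: jbracket_def power_mono)

lemma latnorm_nonneg: "0 \<le> latnorm k"
  by (simp add: latnorm_def)

lemma latnorm_minus_commute: "latnorm (j - k) = latnorm (k - j)"
proof -
  have "lat (j - k) = - lat (k - j)" by (simp add: lat_def vec_eq_iff)
  then show ?thesis by (simp add: latnorm_def)
qed

lemma latnorm_triangle: "latnorm k \<le> latnorm j + latnorm (j - k)"
proof -
  have "lat k = lat j - lat (j - k)" by (simp add: lat_def vec_eq_iff)
  then show ?thesis by (simp add: latnorm_def norm_triangle_ineq4)
qed

text \<open>The argument 2a + b comes from |j| + |k| \<le> 2|j| + |j-k|. With the constant 3 the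
  difference of the squared sides is visibly a sum of nonnegative terms; the constant later enters
  only the operator bound.\<close>

lemma jbracket_two_mult_add_le:
  fixes a b :: real
  shows "jbracket (2 * a + b) \<le> 3 * (jbracket a * jbracket b)"
proof -
  have "1 + (2 * a + b)\<^sup>2 \<le> 9 * ((1 + a\<^sup>2) * (1 + b\<^sup>2))"
  proof -
    have "9 * ((1 + a\<^sup>2) * (1 + b\<^sup>2)) - (1 + (2 * a + b)\<^sup>2)
        = 8 + a\<^sup>2 + 7 * b\<^sup>2 + 9 * (a\<^sup>2 * b\<^sup>2) + (2 * a - b)\<^sup>2"
      by (simp add: power2_eq_square algebra_simps)
    moreover have "0 \<le> 8 + a\<^sup>2 + 7 * b\<^sup>2 + 9 * (a\<^sup>2 * b\<^sup>2) + (2 * a - b)\<^sup>2"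
      by simp
    ultimately show ?thesis by linarith
  qed
  then have "jbracket (2 * a + b) \<le> sqrt (9 * ((1 + a\<^sup>2) * (1 + b\<^sup>2)))"
    by (simp add: jbracket_def)
  also have "\<dots> = 3 * (jbracket a * jbracket b)"
    by (simp add: jbracket_def real_sqrt_mult)
  finally show ?thesis .
qed

lemma jbracket_latnorm_add_le:
  "jbracket (latnorm j + latnorm k) \<le> 3 * (jbracket (latnorm j) * jbracket (latnorm (j - k)))"
proof -
  have "jbracket (latnorm j + latnorm k) \<le> jbracket (2 * latnorm j + latnorm (j - k))"
    using latnorm_triangle[of k j] by (intro jbracket_mono) (auto intro: add_nonneg_nonneg latnorm_nonneg)
  then show ?thesis using jbracket_two_mult_add_le order_trans by blast
qed

lemma jbracket_latnorm_le:
  "jbracket (latnorm k) \<le> 3 * (jbracket (latnorm j) * jbracket (latnorm (j - k)))"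
  using jbracket_latnorm_add_le[of j k] jbracket_mono[of "latnorm k" "latnorm j + latnorm k"]
    latnorm_nonneg[of j] latnorm_nonneg[of k] by linarith

text \<open>For s \<ge> 0 the bracket inequality is raised to the power s. For s < 0 it is used with
  j and k exchanged, raised to -s, and then reciprocals are taken.\<close>

lemma Peetre_inequality:
  "jbracket (latnorm j) powr s \<le>
     3 powr \<bar>s\<bar> * jbracket (latnorm k) powr s * jbracket (latnorm (j - k)) powr \<bar>s\<bar>"
proof (cases "0 \<le> s")
  case True
  have "jbracket (latnorm j) powr s \<le>
      (3 * (jbracket (latnorm k) * jbracket (latnorm (j - k)))) powr s"
    using True jbracket_latnorm_le[of j k] jbracket_pos
    by (intro powr_mono2) (auto simp: latnorm_minus_commute intro: less_imp_le)
  then show ?thesis using True by (simp add: powr_mult jbracket_pos less_imp_le mult_ac)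
next
  case False
  have "jbracket (latnorm k) powr - s \<le>
      (3 * (jbracket (latnorm j) * jbracket (latnorm (j - k)))) powr - s"
    using False jbracket_latnorm_le[of k j] jbracket_pos
    by (intro powr_mono2) (auto intro: less_imp_le)
  also have "\<dots> = 3 powr - s * jbracket (latnorm j) powr - s * jbracket (latnorm (j - k)) powr - s"
    by (simp add: powr_mult jbracket_pos less_imp_le mult_ac)
  finally show ?thesis
    using False jbracket_pos[of "latnorm j"] jbracket_pos[of "latnorm k"]
      jbracket_pos[of "latnorm (j - k)"]
    by (simp add: powr_minus inverse_eq_divide pos_le_divide_eq mult_ac)
qed

text \<open>The mixed bracket is first reduced to a power of <j>, at the cost <j-k>^\<omega> if
  \<omega> \<ge> 0 and at no cost if \<omega> < 0. Peetre's inequality with exponent s + \<omega>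
  then moves the collected power from j to k. The two costs add up to \<open>e\<close>.\<close>

lemma weight_transfer:
  fixes s \<omega> :: real
  defines "e \<equiv> max \<omega> 0 + \<bar>s + \<omega>\<bar>"
  shows "jbracket (latnorm j) powr s * jbracket (latnorm j + latnorm k) powr \<omega> \<le>
    3 powr e * jbracket (latnorm k) powr (s + \<omega>) * jbracket (latnorm (j - k)) powr e"
proof -
  let ?J = "jbracket (latnorm j)" and ?D = "jbracket (latnorm (j - k))"
  have "jbracket (latnorm j + latnorm k) powr \<omega> \<le> 3 powr max \<omega> 0 * ?J powr \<omega> * ?D powr max \<omega> 0"
  proof (cases "0 \<le> \<omega>")
    case True
    have "jbracket (latnorm j + latnorm k) powr \<omega> \<le> (3 * (?J * ?D)) powr \<omega>"
      using True jbracket_latnorm_add_le[of j k] jbracket_pos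
      by (intro powr_mono2) (auto intro: less_imp_le)
    then show ?thesis using True by (simp add: powr_mult jbracket_pos less_imp_le mult_ac max_def)
  next
    case False
    have "jbracket (latnorm j + latnorm k) powr \<omega> \<le> ?J powr \<omega>"
      using False jbracket_pos latnorm_nonneg by (intro powr_mono2' jbracket_mono) auto
    then show ?thesis using False jbracket_pos[of "latnorm (j - k)"] by (simp add: max_def)
  qed
  then have "?J powr s * jbracket (latnorm j + latnorm k) powr \<omega>
      \<le> ?J powr s * (3 powr max \<omega> 0 * ?J powr \<omega> * ?D powr max \<omega> 0)"
    by (intro mult_left_mono) auto
  also have "\<dots> = 3 powr max \<omega> 0 * ?D powr max \<omega> 0 * ?J powr (s + \<omega>)"
    by (simp add: powr_add mult_ac)
  also have "\<dots> \<le> 3 powr max \<omega> 0 * ?D powr max \<omega> 0 *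
      (3 powr \<bar>s + \<omega>\<bar> * jbracket (latnorm k) powr (s + \<omega>) * ?D powr \<bar>s + \<omega>\<bar>)"
    by (intro mult_left_mono Peetre_inequality) auto
  also have "\<dots> = 3 powr e * jbracket (latnorm k) powr (s + \<omega>) * ?D powr e"
    unfolding e_def powr_add by (simp add: mult_ac)
  finally show ?thesis .
qed

text \<open>Each bracket on the left is at most <x+y>, and the exponents are nonnegative. Read from
  right to left, this splits the joint decay of the tensor into one factor for k and one for
  l.\<close>

lemma powr_mult_jbracket_le:
  fixes x y :: real
  assumes "0 \<le> x" "0 \<le> y" "0 \<le> a" "0 \<le> b"
  shows "jbracket x powr a * jbracket y powr b \<le> jbracket (x + y) powr (a + b)"
  unfolding powr_add using assms jbracket_pos
  by (intro mult_mono powr_mono2 jbracket_mono) (auto intro: less_imp_le)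

section \<open>Summability of bracket powers on the lattice\<close>

lemma summable_on_jbracket_int:
  assumes "1 < a"
  shows "(\<lambda>n::int. jbracket (real_of_int n) powr - a) summable_on UNIV"
proof -
  let ?g = "\<lambda>n::nat. jbracket (real n) powr - a"
  have "summable (\<lambda>n. real n powr - a)"
    using assms by (simp add: summable_real_powr_iff)
  \<comment> \<open>The comparison fails at n = 0, where \<open>0 powr - a\<close> is 0 while the
    bracket is 1.\<close>
  moreover have "jbracket (real n) powr - a \<le> real n powr - a" if "1 \<le> n" for n
  proof -
    have "real n \<le> jbracket (real n)"
      unfolding jbracket_def by (rule real_le_rsqrt) simp
    then show ?thesis using that assms by (intro powr_mono2') auto
  qed
  ultimately have "summable ?g"
    by (intro summable_comparison_test[of ?g "\<lambda>n. real n powr - a"]) auto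
  then have g: "?g summable_on UNIV"
    by (simp add: summable_on_UNIV_nonneg_real_iff)
  have bij: "inj_on (int :: nat \<Rightarrow> int) UNIV" "inj_on (\<lambda>n. - int n) UNIV"
    by (auto simp: inj_on_def)
  have "(\<lambda>n::int. jbracket (real_of_int n) powr - a) summable_on range int"
       "(\<lambda>n::int. jbracket (real_of_int n) powr - a) summable_on range (\<lambda>n. - int n)"
    using g by (simp_all add: summable_on_reindex[OF bij(1)] summable_on_reindex[OF bij(2)] o_def jbracket_def)
  moreover have "(UNIV :: int set) = range int \<union> range (\<lambda>n. - int n)"
  proof -
    have "x \<in> range int \<union> range (\<lambda>n. - int n)" for x :: int
      by (cases x rule: int_cases2) auto
    then show ?thesis by blast
  qed
  ultimately show ?thesis by (metis summable_on_union)
qed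

text \<open>A finite set of vectors lies in the box spanned by its coordinate projections. Over a
  box the sum of products is a product of sums, hence bounded by the d-th power of the full sum of
  h.\<close>

lemma summable_on_prod_vec:
  fixes h :: "'a \<Rightarrow> real"
  assumes h: "h summable_on UNIV" "\<And>n. 0 \<le> h n"
  shows "(\<lambda>k :: 'a ^ 'd. \<Prod>i\<in>UNIV. h (k $ i)) summable_on UNIV"
proof (rule nonneg_bdd_above_summable_on)
  show "bdd_above (sum (\<lambda>k :: 'a ^ 'd. \<Prod>i\<in>UNIV. h (k $ i)) ` {F. F \<subseteq> UNIV \<and> finite F})"
  proof (rule bdd_aboveI2)
    fix F :: "('a ^ 'd) set" assume "F \<in> {F. F \<subseteq> UNIV \<and> finite F}"
    then have F: "finite F" by simp
    define B where "B i = (\<lambda>k. k $ i) ` F" for i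
    have fin: "finite (PiE UNIV B)" using F by (intro finite_PiE) (auto simp: B_def)
    have "(\<Sum>k\<in>F. \<Prod>i\<in>UNIV. h (k $ i)) = (\<Sum>g\<in>(\<lambda>k. ($) k) ` F. \<Prod>i\<in>UNIV. h (g i))"
      by (subst sum.reindex) (auto simp: inj_on_def vec_eq_iff)
    also have "\<dots> \<le> (\<Sum>g\<in>PiE UNIV B. \<Prod>i\<in>UNIV. h (g i))"
      using fin h by (intro sum_mono2 prod_nonneg) (auto simp: B_def)
    also have "\<dots> = (\<Prod>i\<in>UNIV. \<Sum>n\<in>B i. h n)"
      using F by (subst prod_sum_PiE) (auto simp: B_def)
    also have "\<dots> \<le> (\<Prod>i\<in>(UNIV::'d set). infsum h UNIV)"
      using F h by (intro prod_mono conjI sum_nonneg finite_sum_le_infsum) (auto simp: B_def)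
    finally show "(\<Sum>k\<in>F. \<Prod>i\<in>UNIV. h (k $ i)) \<le> (\<Prod>i\<in>(UNIV::'d set). infsum h UNIV)" .
  qed
qed (use h in \<open>auto intro: prod_nonneg\<close>)

text \<open>Since |k_i| \<le> |k|, splitting <k>^(-a) into d equal factors bounds it by the product
  of <k_i>^(-a/d). This reduces the claim to one dimension with exponent a/d > 1, and no lattice
  points have to be counted.\<close>

lemma summable_on_jbracket_latnorm:
  assumes "real CARD('d) < a"
  shows "(\<lambda>k :: int ^ 'd. jbracket (latnorm k) powr - a) summable_on UNIV"
proof (rule summable_on_comparison_test)
  define b where "b = a / real CARD('d)"
  have b: "1 < b" using assms by (simp add: b_def)
  show "(\<lambda>k :: int ^ 'd. \<Prod>i\<in>UNIV. jbracket (real_of_int (k $ i)) powr - b) summable_on UNIV"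
    by (rule summable_on_prod_vec[OF summable_on_jbracket_int[OF b]]) simp
  show "jbracket (latnorm k) powr - a \<le> (\<Prod>i\<in>UNIV. jbracket (real_of_int (k $ i)) powr - b)"
    for k :: "int ^ 'd"
  proof -
    have "jbracket (latnorm k) powr - a = (\<Prod>i\<in>(UNIV::'d set). jbracket (latnorm k) powr - b)"
      using jbracket_pos[of "latnorm k"] by (simp add: powr_realpow[symmetric] powr_powr b_def)
    also have "\<dots> \<le> (\<Prod>i\<in>UNIV. jbracket (real_of_int (k $ i)) powr - b)"
    proof (intro prod_mono conjI powr_mono2')
      fix i
      have "\<bar>real_of_int (k $ i)\<bar> \<le> latnorm k"
        using component_le_norm_cart[of "lat k" i] by (simp add: latnorm_def lat_def)
      then have "jbracket \<bar>real_of_int (k $ i)\<bar> \<le> jbracket (latnorm k)"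
        by (intro jbracket_mono) auto
      then show "jbracket (real_of_int (k $ i)) \<le> jbracket (latnorm k)"
        by (simp add: jbracket_def)
    qed (use b jbracket_pos in auto)
    finally show ?thesis .
  qed
qed simp

section \<open>Weighted sequence spaces in terms of l^p bounds\<close>

lemma ell_weight_powr:
  fixes f :: "int ^ 'd \<Rightarrow> complex"
  shows "(jbracket (lat k) powr s * cmod (f k)) powr p = jbracket (lat k) powr (s * p) * cmod (f k) powr p"
  by (simp add: powr_mult powr_powr)

lemma ell_norm_nonneg:
  fixes f :: "int ^ 'd \<Rightarrow> complex"
  assumes "f \<in> ell_space p s"
  shows "0 \<le> ell_norm p s f"
proof (cases "p = \<infinity>")
  case True
  have "0 \<le> jbracket (lat (0 :: int ^ 'd)) powr s * cmod (f 0)" by simp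
  also have "\<dots> \<le> (SUP k. jbracket (lat k) powr s * cmod (f k))"
    using assms True by (intro cSUP_upper) (auto simp: ell_space_def)
  finally show ?thesis using True by (simp add: ell_norm_def)
qed (simp add: ell_norm_def)

lemma ell_space_imp_lp_le:
  assumes "1 \<le> p" "f \<in> ell_space p s"
  shows "lp_le p (ell_norm p s f) (\<lambda>k. jbracket (lat k) powr s * cmod (f k))"
proof (cases p)
  case (real p')
  then have p': "1 \<le> p'" using assms(1) by (metis ennreal_ge_1)
  let ?w = "\<lambda>k. jbracket (lat k) powr (s * p') * cmod (f k) powr p'"
  have summ: "?w summable_on UNIV" using assms(2) real by (simp add: ell_space_def)
  \<comment> \<open>The root in \<open>ell_norm\<close> and the p'-th power cancel on nonnegative
    reals.\<close>
  then have "0 \<le> infsum ?w UNIV" by (intro infsum_nonneg) auto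
  then have "ell_norm p s f powr p' = infsum ?w UNIV"
    using real p' by (simp add: ell_norm_def powr_powr)
  moreover have "sum ?w S \<le> infsum ?w UNIV" if "finite S" for S
    using that summ by (intro finite_sum_le_infsum) auto
  ultimately show ?thesis
    using real by (simp add: lp_le_ennreal ell_weight_powr)
next
  case top
  have "jbracket (lat k) powr s * cmod (f k) \<le> (SUP k. jbracket (lat k) powr s * cmod (f k))" for k
    using assms top by (intro cSUP_upper) (auto simp: ell_space_def)
  then show ?thesis using top by (simp add: ell_norm_def)
qed

text \<open>Bounded finite sums of nonnegative terms yield summability, hence membership, and at the
  same time bound the total.\<close>

lemma lp_le_imp_ell_space:
  assumes "1 \<le> p" "0 \<le> A" "lp_le p A (\<lambda>k. jbracket (lat k) powr s * cmod (f k))"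
  shows "f \<in> ell_space p s" "ell_norm p s f \<le> A"
proof -
  have "f \<in> ell_space p s \<and> ell_norm p s f \<le> A"
  proof (cases p)
    case (real p')
    then have p': "1 \<le> p'" using assms(1) by (metis ennreal_ge_1)
    let ?w = "\<lambda>k. jbracket (lat k) powr (s * p') * cmod (f k) powr p'"
    have le: "sum ?w S \<le> A powr p'" if "finite S" for S
      using assms(3) real that by (simp add: lp_le_ennreal ell_weight_powr)
    have summ: "?w summable_on UNIV"
      by (rule nonneg_bdd_above_summable_on) (auto intro!: bdd_aboveI2 le)
    have "infsum ?w UNIV powr (1 / p') \<le> (A powr p') powr (1 / p')"
      using p' summ le by (intro powr_mono2 infsum_le_finite_sums infsum_nonneg) auto
    also have "\<dots> = A" using assms(2) p' by (simp add: powr_powr)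
    finally show ?thesis using summ real by (simp add: ell_space_def ell_norm_def)
  next
    case top
    then show ?thesis using assms(3)
      by (auto simp: ell_space_def ell_norm_def intro!: bdd_aboveI2[of _ _ A] cSUP_least)
  qed
  then show "f \<in> ell_space p s" "ell_norm p s f \<le> A" by auto
qed

section \<open>Decoupled bound for the tensor\<close>

lemma tensor_norm_finiteE:
  assumes "tensor_norm \<omega> N \<Theta> < \<infinity>"
  obtains M where "0 \<le> M"
    "\<And>j k l. cmod (\<Theta> j k l) * jbracket (latnorm (j - k) + latnorm (j - l)) ^ (2 * N) \<le>
      M * (jbracket (latnorm j + latnorm k) powr \<omega> * jbracket (latnorm j + latnorm l) powr \<omega>)"
proof
  show "0 \<le> enn2real (tensor_norm \<omega> N \<Theta>)" by simp
  fix j k l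
  let ?n = "cmod (\<Theta> j k l) * jbracket (latnorm (j - k) + latnorm (j - l)) ^ (2 * N)"
  let ?m = "jbracket (latnorm j + latnorm k) powr \<omega> * jbracket (latnorm j + latnorm l) powr \<omega>"
  have m: "0 < ?m" using jbracket_pos by (metis mult_pos_pos powr_gt_zero less_irrefl)
  have "ennreal (?n / ?m) \<le> tensor_norm \<omega> N \<Theta>"
    unfolding tensor_norm_def by (rule SUP_upper2[of "(j, k, l)"]) auto
  \<comment> \<open>Finiteness enters here: \<open>enn2real\<close> maps \<infinity> to 0.\<close>
  also have "\<dots> = ennreal (enn2real (tensor_norm \<omega> N \<Theta>))"
    using assms by simp
  finally have "?n / ?m \<le> enn2real (tensor_norm \<omega> N \<Theta>)"
    by (subst (asm) ennreal_le_iff) auto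
  then show "?n \<le> enn2real (tensor_norm \<omega> N \<Theta>) * ?m"
    using m by (simp add: pos_divide_le_eq)
qed

lemma weighted_tensor_bound:
  fixes \<Theta> :: "int ^ 'd \<Rightarrow> int ^ 'd \<Rightarrow> int ^ 'd \<Rightarrow> complex"
  assumes N: "real N > N0 CARD('d) \<omega> s1 s2" and fin: "tensor_norm \<omega> N \<Theta> < \<infinity>"
  obtains C a where "0 \<le> C" "real CARD('d) < a"
    "\<And>j k l. jbracket (latnorm j) powr (s1 + s2) * cmod (\<Theta> j k l) \<le>
      C * ((jbracket (latnorm (j - k)) powr - a * jbracket (latnorm k) powr (s1 + \<omega>)) *
           (jbracket (latnorm (j - l)) powr - a * jbracket (latnorm l) powr (s2 + \<omega>)))"
proof -
  obtain M where M: "0 \<le> M" "\<And>j k l. cmod (\<Theta> j k l) *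
      jbracket (latnorm (j - k) + latnorm (j - l)) ^ (2 * N) \<le>
      M * (jbracket (latnorm j + latnorm k) powr \<omega> * jbracket (latnorm j + latnorm l) powr \<omega>)"
    using tensor_norm_finiteE[OF fin] by blast
  \<comment> \<open>The slack in \<open>N > N\<^sub>0\<close> is shared equally, so that both factors decay faster than \<open>\<langle>\<cdot>\<rangle>\<^bsup>-d\<^esup>\<close>.\<close>
  define a where "a = real CARD('d) + (real N - N0 CARD('d) \<omega> s1 s2)"
  define e1 where "e1 = max \<omega> 0 + \<bar>s1 + \<omega>\<bar>"
  define e2 where "e2 = max \<omega> 0 + \<bar>s2 + \<omega>\<bar>"
  have a: "real CARD('d) < a" using N by (simp add: a_def)
  have nonneg: "0 \<le> a + e1" "0 \<le> a + e2" using a by (auto simp: e1_def e2_def)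
  have split: "(a + e1) + (a + e2) = real (2 * N)"
    by (simp add: a_def e1_def e2_def N0_def field_simps)
  have "jbracket (latnorm j) powr (s1 + s2) * cmod (\<Theta> j k l) \<le>
      (M * 3 powr (e1 + e2)) *
        ((jbracket (latnorm (j - k)) powr - a * jbracket (latnorm k) powr (s1 + \<omega>)) *
         (jbracket (latnorm (j - l)) powr - a * jbracket (latnorm l) powr (s2 + \<omega>)))" for j k l
  proof -
    define J where "J = jbracket (latnorm j)"
    define Dk where "Dk = jbracket (latnorm (j - k))"
    define Dl where "Dl = jbracket (latnorm (j - l))"
    define U where "U = jbracket (latnorm k) powr (s1 + \<omega>)"
    define V where "V = jbracket (latnorm l) powr (s2 + \<omega>)"
    \<comment> \<open>Of each exponent, the part e1 or e2 pays for the transfer of weights and the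
      part a remains as decay of the kernel.\<close>
    define D where "D = Dk powr (a + e1) * Dl powr (a + e2)"
    have pos: "0 < Dk" "0 < Dl" by (simp_all add: Dk_def Dl_def jbracket_pos)
    then have D: "0 < D" by (simp add: D_def)
    have "D \<le> jbracket (latnorm (j - k) + latnorm (j - l)) powr real (2 * N)"
      unfolding D_def Dk_def Dl_def split[symmetric]
      by (intro powr_mult_jbracket_le latnorm_nonneg nonneg)
    also have "\<dots> = jbracket (latnorm (j - k) + latnorm (j - l)) ^ (2 * N)"
      by (rule powr_realpow[OF jbracket_pos])
    finally have "cmod (\<Theta> j k l) * D \<le>
        M * (jbracket (latnorm j + latnorm k) powr \<omega> * jbracket (latnorm j + latnorm l) powr \<omega>)"
      using M(2)[of j k l] by (meson mult_left_mono norm_ge_zero order_trans)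
    then have "J powr (s1 + s2) * (cmod (\<Theta> j k l) * D) \<le> J powr (s1 + s2) *
        (M * (jbracket (latnorm j + latnorm k) powr \<omega> * jbracket (latnorm j + latnorm l) powr \<omega>))"
      by (intro mult_left_mono) auto
    also have "\<dots> = M * ((J powr s1 * jbracket (latnorm j + latnorm k) powr \<omega>) *
        (J powr s2 * jbracket (latnorm j + latnorm l) powr \<omega>))"
      by (simp add: powr_add mult_ac)
    also have "\<dots> \<le> M * ((3 powr e1 * U * Dk powr e1) * (3 powr e2 * V * Dl powr e2))"
      unfolding J_def U_def V_def Dk_def Dl_def e1_def e2_def
      using M(1) by (intro mult_left_mono mult_mono weight_transfer) auto
    \<comment> \<open>Since <j-k>^e1 = <j-k>^(-a) * <j-k>^(a+e1), and likewise for l, the whole of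
      \<open>D\<close> splits off and can be cancelled.\<close>
    also have "\<dots> = (M * 3 powr (e1 + e2)) * ((Dk powr - a * U) * (Dl powr - a * V)) * D"
      using pos by (simp add: D_def powr_add powr_minus field_simps)
    finally have "(J powr (s1 + s2) * cmod (\<Theta> j k l)) * D \<le>
        ((M * 3 powr (e1 + e2)) * ((Dk powr - a * U) * (Dl powr - a * V))) * D"
      by (simp add: mult.assoc)
    then show ?thesis
      using D unfolding J_def U_def V_def Dk_def Dl_def by (rule mult_right_le_imp_le)
  qed
  then show thesis
    using that[of "M * 3 powr (e1 + e2)" a] M(1) a by auto
qed

section \<open>The operator: convergence, bilinearity and boundedness\<close>

text \<open>A majorant of product form allows one variable to be summed at a time: the inner sum is
  at most \<open>u k\<close> times the total of v, which is again summable in k.\<close>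

lemma iterated_sum_dominated:
  fixes h :: "'a \<Rightarrow> 'b \<Rightarrow> complex"
  assumes h: "\<And>k l. cmod (h k l) \<le> u k * v l"
    and u: "\<And>k. 0 \<le> u k" "u summable_on UNIV"
    and v: "\<And>l. 0 \<le> v l" "v summable_on UNIV"
  shows "h k summable_on UNIV" "(\<lambda>k. \<Sum>\<^sub>\<infinity>l. h k l) summable_on UNIV"
    "cmod (\<Sum>\<^sub>\<infinity>k. \<Sum>\<^sub>\<infinity>l. h k l) \<le> infsum u UNIV * infsum v UNIV"
proof -
  have inner: "h k summable_on UNIV" for k
    by (rule abs_summable_summable,
        rule Infinite_Sum.abs_summable_on_comparison_test'[OF summable_on_cmult_right[OF v(2), of "u k"]])
       (use h in auto)
  then show "h k summable_on UNIV" .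
  have bound: "cmod (\<Sum>\<^sub>\<infinity>l. h k l) \<le> u k * infsum v UNIV" for k
    by (rule norm_infsum_le[OF has_sum_infsum[OF inner] has_sum_cmult_right[OF has_sum_infsum[OF v(2)]]])
       (use h in auto)
  have us: "((\<lambda>k. u k * infsum v UNIV) has_sum (infsum u UNIV * infsum v UNIV)) UNIV"
    by (rule has_sum_cmult_left[OF has_sum_infsum[OF u(2)]])
  show outer: "(\<lambda>k. \<Sum>\<^sub>\<infinity>l. h k l) summable_on UNIV"
    by (rule abs_summable_summable,
        rule Infinite_Sum.abs_summable_on_comparison_test'[OF summable_on_cmult_left[OF u(2), of "infsum v UNIV"]])
       (use bound in auto)
  show "cmod (\<Sum>\<^sub>\<infinity>k. \<Sum>\<^sub>\<infinity>l. h k l) \<le> infsum u UNIV * infsum v UNIV"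
    by (rule norm_infsum_le[OF has_sum_infsum[OF outer] us]) (use bound in auto)
qed

text \<open>\<open>infsum\<close> is additive on summable families; convergence supplies this for
  the inner sum and then for the outer one.\<close>

lemma tensor_op_add_left:
  assumes "tensor_op_converges \<Theta> f g" "tensor_op_converges \<Theta> f' g"
  shows "tensor_op \<Theta> (\<lambda>k. f k + f' k) g = (\<lambda>j. tensor_op \<Theta> f g j + tensor_op \<Theta> f' g j)"
  using assms unfolding tensor_op_def tensor_op_converges_def
  by (simp add: distrib_left distrib_right infsum_add)

lemma tensor_op_add_right:
  assumes "tensor_op_converges \<Theta> f g" "tensor_op_converges \<Theta> f g'"
  shows "tensor_op \<Theta> f (\<lambda>l. g l + g' l) = (\<lambda>j. tensor_op \<Theta> f g j + tensor_op \<Theta> f g' j)"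
  using assms unfolding tensor_op_def tensor_op_converges_def
  by (simp add: distrib_left infsum_add)

text \<open>A nonzero c preserves and reflects summability, and c = 0 makes both sides 0, so the
  default value of \<open>infsum\<close> is consistent with scaling.\<close>

lemma tensor_op_cmult_left: "tensor_op \<Theta> (\<lambda>k. c * f k) g = (\<lambda>j. c * tensor_op \<Theta> f g j)"
  by (simp add: tensor_op_def infsum_cmult_right'[symmetric] mult_ac)

lemma tensor_op_cmult_right: "tensor_op \<Theta> f (\<lambda>l. c * g l) = (\<lambda>j. c * tensor_op \<Theta> f g j)"
  by (simp add: tensor_op_def infsum_cmult_right'[symmetric] mult_ac)

theorem proposition3p1:
  fixes s1 s2 \<omega> :: real
    and \<Theta> :: "int ^ 'd \<Rightarrow> int ^ 'd \<Rightarrow> int ^ 'd \<Rightarrow> complex"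
    and N :: nat
    and p q r :: ennreal
  assumes "real N > N0 CARD('d) \<omega> s1 s2"
    and "tensor_norm \<omega> N \<Theta> < \<infinity>"
    and "1 \<le> p" and "1 \<le> q" and "1 \<le> r"
    and "1 / p + 1 / q = 1 / r"
  shows "(\<forall>f \<in> ell_space p (s1 + \<omega>). \<forall>g \<in> ell_space q (s2 + \<omega>). tensor_op_converges \<Theta> f g) \<and>
    bounded_bilinear_between
      (ell_space p (s1 + \<omega>)) (ell_norm p (s1 + \<omega>))
      (ell_space q (s2 + \<omega>)) (ell_norm q (s2 + \<omega>))
      (ell_space r (s1 + s2)) (ell_norm r (s1 + s2))
      (tensor_op \<Theta>)"
proof -
  obtain C a where C: "0 \<le> C" and a: "real CARD('d) < a" and bound:
    "\<And>j k l. jbracket (latnorm j) powr (s1 + s2) * cmod (\<Theta> j k l) \<le>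
      C * ((jbracket (latnorm (j - k)) powr - a * jbracket (latnorm k) powr (s1 + \<omega>)) *
           (jbracket (latnorm (j - l)) powr - a * jbracket (latnorm l) powr (s2 + \<omega>)))"
    using weighted_tensor_bound[OF assms(1,2)] by blast
  define K where "K m = jbracket (latnorm m) powr - a" for m :: "int ^ 'd"
  have K: "0 \<le> K m" "K summable_on UNIV" for m
    unfolding K_def using summable_on_jbracket_latnorm[OF a] by simp_all
  define \<kappa> where "\<kappa> = infsum K UNIV"
  have \<kappa>: "0 \<le> \<kappa>" unfolding \<kappa>_def using K by (simp add: infsum_nonneg)
  \<comment> \<open>Convergence is proved along with the bound because additivity in f and in g
    rests on it.\<close>
  have main: "tensor_op_converges \<Theta> f g \<and> tensor_op \<Theta> f g \<in> ell_space r (s1 + s2) \<and>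
      ell_norm r (s1 + s2) (tensor_op \<Theta> f g) \<le>
        C * \<kappa>\<^sup>2 * ell_norm p (s1 + \<omega>) f * ell_norm q (s2 + \<omega>) g"
    if f: "f \<in> ell_space p (s1 + \<omega>)" and g: "g \<in> ell_space q (s2 + \<omega>)" for f g
  proof -
    define F where "F k = jbracket (lat k) powr (s1 + \<omega>) * cmod (f k)" for k
    define G where "G l = jbracket (lat l) powr (s2 + \<omega>) * cmod (g l)" for l
    define A where "A = ell_norm p (s1 + \<omega>) f"
    define B where "B = ell_norm q (s2 + \<omega>) g"
    have F: "lp_le p A F" "\<And>k. 0 \<le> F k" "0 \<le> A"
      using ell_space_imp_lp_le[OF assms(3) f] ell_norm_nonneg[OF f]
      by (simp_all add: A_def F_def[abs_def])
    have G: "lp_le q B G" "\<And>k. 0 \<le> G k" "0 \<le> B"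
      using ell_space_imp_lp_le[OF assms(4) g] ell_norm_nonneg[OF g]
      by (simp_all add: B_def G_def[abs_def])
    note YF = Young_lp_le[OF assms(3) K F, folded \<kappa>_def]
    note YG = Young_lp_le[OF assms(4) K G, folded \<kappa>_def]
    define P where "P j = (\<Sum>\<^sub>\<infinity>k. K (j - k) * F k)" for j
    define Q where "Q j = (\<Sum>\<^sub>\<infinity>l. K (j - l) * G l)" for j
    have PQ: "0 \<le> P j" "0 \<le> Q j" for j
      unfolding P_def Q_def using K F G by (auto intro!: infsum_nonneg)
    define W where "W j = jbracket (lat j) powr (s1 + s2)" for j :: "int ^ 'd"
    have W: "0 < W j" for j using jbracket_pos[of "lat j"] by (simp add: W_def)
    \<comment> \<open>For fixed j the output weight is a constant; dividing by it and placing 1 /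
      \<open>W j\<close> in the factor for k keeps the majorant a product.\<close>
    have dom: "cmod (\<Theta> j k l * f k * g l) \<le> (C / W j * (K (j - k) * F k)) * (K (j - l) * G l)" for j k l
    proof -
      have "W j * cmod (\<Theta> j k l) * (cmod (f k) * cmod (g l)) \<le>
        C * ((K (j - k) * jbracket (lat k) powr (s1 + \<omega>)) *
           (K (j - l) * jbracket (lat l) powr (s2 + \<omega>))) * (cmod (f k) * cmod (g l))"
        using bound[of j k l] unfolding W_def K_def jbracket_lat
        by (intro mult_right_mono) auto
      also have "\<dots> = C * (K (j - k) * F k) * (K (j - l) * G l)"
        by (simp add: F_def G_def mult_ac)
      finally show ?thesis using W[of j] by (simp add: norm_mult field_simps)
    qed
    have dom_nonneg: "0 \<le> C / W j * (K (j - k) * F k)" "0 \<le> K (j - k) * G k" for j k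
      using C K F G W[of j] by auto
    note iter = iterated_sum_dominated[OF dom dom_nonneg(1) summable_on_cmult_right[OF YF(1)]
        dom_nonneg(2) YG(1)]
    have conv: "tensor_op_converges \<Theta> f g"
      unfolding tensor_op_converges_def using iter(1,2) by blast
    have T: "W j * cmod (tensor_op \<Theta> f g j) \<le> C * (P j * Q j)" for j
    proof -
      have "cmod (tensor_op \<Theta> f g j) \<le> C / W j * P j * Q j"
        using iter(3)[of j] unfolding tensor_op_def P_def Q_def infsum_cmult_right' .
      then show ?thesis using W[of j] by (simp add: field_simps)
    qed
    have "lp_le r ((\<kappa> * A) * (\<kappa> * B)) (\<lambda>j. P j * Q j)"
      using Hoelder_lp_le[OF assms(3-6), of "\<kappa> * A" P "\<kappa> * B" Q] YF(2) YG(2) PQ \<kappa> F(3) G(3)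
      by (simp add: P_def[abs_def] Q_def[abs_def])
    then have "lp_le r (C * ((\<kappa> * A) * (\<kappa> * B))) (\<lambda>j. C * (P j * Q j))"
      using PQ \<kappa> F(3) G(3) C by (intro lp_le_cmult) auto
    then have lp: "lp_le r (C * ((\<kappa> * A) * (\<kappa> * B))) (\<lambda>j. W j * cmod (tensor_op \<Theta> f g j))"
      using T less_imp_le[OF W] by (elim lp_le_mono) simp_all
    have nonneg: "0 \<le> C * ((\<kappa> * A) * (\<kappa> * B))" using C \<kappa> F(3) G(3) by simp
    have eq: "C * ((\<kappa> * A) * (\<kappa> * B)) = C * \<kappa>\<^sup>2 * A * B" by (simp add: power2_eq_square mult_ac)
    then show ?thesis
      using conv lp_le_imp_ell_space[OF assms(5) nonneg lp[unfolded W_def]]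
      unfolding eq by (simp add: A_def B_def)
  qed
  then have "\<exists>C. \<forall>f\<in>ell_space p (s1 + \<omega>). \<forall>g\<in>ell_space q (s2 + \<omega>).
      ell_norm r (s1 + s2) (tensor_op \<Theta> f g) \<le> C * ell_norm p (s1 + \<omega>) f * ell_norm q (s2 + \<omega>) g"
    by blast
  then show ?thesis
    using main unfolding bounded_bilinear_between_def
    by (simp add: tensor_op_add_left tensor_op_add_right tensor_op_cmult_left tensor_op_cmult_right)
qed

end
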